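(* Let $X$ be a real Banach space, let $Y$ be a closed linear subspace of $X$, and let $\mathcal{F}=\{F \in CB(X): rad_{Y}(F) \leq \alpha\}$ for some $\alpha>0$. Then the following statements are equivalent. (1) $X$ is quasi uniformly rotund with respect to $Y$. (2) $(Y, \mathcal{F})$ has property-$(P_2)$. (3) The restricted center map $Z_Y$ is non-empty valued and uniformly Hausdorff continuous on $(\mathcal{F}, \mathcal{H})$.
   Context: $CL(X)$ and $CB(X)$ denote the sets of non-empty closed, respectively non-empty closed bounded, subsets of $X$; $B_X$ is the closed unit ball of $X$, and $B[x,r]$ is the closed ball with center $x$ and radius $r>0$. For $x\in X$ and $F\in CB(X)$, $r(x,F)=\sup\{\|x-a\|: a\in F\}$. For $V\in CL(X)$, $rad_V(F)=\inf\{r(v,F): v\in V\}$, $Z_V(F)=\{v\in V: r(v,F)=rad_V(F)\}$, and for $\delta\ge 0$, $Z_V(F,\delta)=\{v\in V: r(v,F)\le rad_V(F)+\delta\}$. The restricted center map is $F\mapsto Z_V(F)$. $\mathcal{H}$ is the Hausdorff metric on $CB(X)$: $\mathcal{H}(A,B)=\inf\{r>0: A\subseteq B+rB_X,\ B\subseteq A+rB_X\}$. Property-$(P_2)$: $(V,\mathcal{F})$ has property-$(P_2)$ if $Z_V(G)\ne\emptyset$ for every $G\in\mathcal{F}$ and for every $\epsilon>0$ there exists $\delta>0$ such that $Z_V(G,\delta)\subseteq Z_V(G)+\epsilon B_X$ for every $G\in\mathcal{F}$. Uniform Hausdorff continuity: a map $T$ from a metric space $(N,d)$ to $(CB(X),\mathcal{H})$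 is uniformly Hausdorff continuous on $N$ if for every $\epsilon>0$ there exists $\delta>0$ such that $\mathcal{H}(T(a),T(b))<\epsilon$ whenever $a,b\in N$ and $d(a,b)<\delta$. Quasi uniform rotundity: $X$ is quasi uniformly rotund with respect to $Y$ if for every $\epsilon>0$ there exists $\delta$ with $0<\delta<1$ such that for every $v\in Y$ there exists $w\in Y$ such that $w\in B[0,\epsilon]$ and $B[0,1]\cap B[v,1-\delta]\subseteq B[w,1-\delta]$. *)

theory Defs
  imports "HOL-Analysis.Analysis" "HOL-Library.Set_Algebras"
begin

definition CB :: "'a::real_normed_vector set set" where
  "CB = {F. F \<noteq> {} \<and> closed F \<and> bounded F}"

text \<open>The suprema and infima below are taken in the conditionally complete type of reals.
  They are meaningful for nonempty bounded \<open>F\<close> and nonempty \<open>V\<close>.\<close>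

definition far_radius :: "'a::real_normed_vector \<Rightarrow> 'a set \<Rightarrow> real" where
  "far_radius x F = (SUP a\<in>F. norm (x - a))"

definition restricted_radius :: "'a::real_normed_vector set \<Rightarrow> 'a set \<Rightarrow> real" where
  "restricted_radius V F = (INF v\<in>V. far_radius v F)"

definition center_set :: "'a::real_normed_vector set \<Rightarrow> 'a set \<Rightarrow> 'a set" where
  "center_set V F = {v \<in> V. far_radius v F = restricted_radius V F}"

definition near_center_set ::
    "'a::real_normed_vector set \<Rightarrow> 'a set \<Rightarrow> real \<Rightarrow> 'a set" where
  "near_center_set V F \<delta> = {v \<in> V. far_radius v F \<le> restricted_radius V F + \<delta>}"

text \<open>Here \<open>+\<close> on sets is the Minkowski sum, so the summand \<open>(*\<^sub>R) r ` cball 0 1\<close> is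
  \<open>r B\<^sub>X\<close>.\<close>

definition Hausdorff_metric :: "'a::real_normed_vector set \<Rightarrow> 'a set \<Rightarrow> real" where
  "Hausdorff_metric A B =
     Inf {r. r > 0 \<and> A \<subseteq> B + (*\<^sub>R) r ` cball 0 1 \<and> B \<subseteq> A + (*\<^sub>R) r ` cball 0 1}"

definition property_P2 ::
    "'a::real_normed_vector set \<Rightarrow> 'a set set \<Rightarrow> bool" where
  "property_P2 V \<F> \<longleftrightarrow>
     (\<forall>G\<in>\<F>. center_set V G \<noteq> {}) \<and>
     (\<forall>\<epsilon>>0. \<exists>\<delta>>0. \<forall>G\<in>\<F>.
        near_center_set V G \<delta> \<subseteq> center_set V G + (*\<^sub>R) \<epsilon> ` cball 0 1)"

text \<open>The first conjunct says that \<open>T\<close> maps the metric space \<open>(N, d)\<close> into \<open>CB\<close>, where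
  the Hausdorff metric lives.\<close>

definition uniformly_Hausdorff_continuous_on ::
    "'b set \<Rightarrow> ('b \<Rightarrow> 'b \<Rightarrow> real) \<Rightarrow> ('b \<Rightarrow> 'a::real_normed_vector set) \<Rightarrow> bool" where
  "uniformly_Hausdorff_continuous_on N d T \<longleftrightarrow>
     T ` N \<subseteq> CB \<and>
     (\<forall>\<epsilon>>0. \<exists>\<delta>>0. \<forall>a\<in>N. \<forall>b\<in>N. d a b < \<delta> \<longrightarrow> Hausdorff_metric (T a) (T b) < \<epsilon>)"

text \<open>The ambient space \<open>X\<close> is the whole type.\<close>

definition quasi_uniformly_rotund_wrt :: "'a::real_normed_vector set \<Rightarrow> bool" where
  "quasi_uniformly_rotund_wrt Y \<longleftrightarrow>
     (\<forall>\<epsilon>>0. \<exists>\<delta>. 0 < \<delta> \<and> \<delta> < 1 \<and>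
        (\<forall>v\<in>Y. \<exists>w\<in>Y. w \<in> cball 0 \<epsilon> \<and>
           cball 0 1 \<inter> cball v (1 - \<delta>) \<subseteq> cball w (1 - \<delta>)))"

end

theory Submission
  imports Defs
begin

text \<open>
  (1) implies (2): rescaling turns rotundity into an additive statement, in which \<open>cball u s\<close>
  and \<open>cball v \<rho>\<close> with \<open>s \<le> \<rho> + \<delta>\<close> can be replaced by a ball of radius \<open>\<rho>\<close> about a point near
  \<open>u\<close>. Iterating it with summable displacements moves an almost-center to a center.
  (2) implies (1): the required \<open>w\<close> is a center of \<open>G = cball 0 1 \<inter> cball v (1 - \<delta>)\<close> near \<open>0\<close>
  if the radius of \<open>G\<close> is close to 1, and otherwise lies on the segment from \<open>0\<close> to a center
  of \<open>G\<close>. Both implications hold at every level \<open>\<alpha>\<close>, so (2) does not depend on \<open>\<alpha>\<close>.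

  (3) implies (2) at level \<open>\<alpha>/2\<close>: let \<open>z\<close> be a center of \<open>G\<close>, with radius \<open>R\<close>, and let \<open>v\<close> be
  an almost-center, with radius at most \<open>R + d\<close>. The sets \<open>G \<union> (v + z - G + d B)\<close> and
  \<open>(G + d B) \<union> (v + z - G)\<close> are at Hausdorff distance at most \<open>d\<close> and have radius \<open>R + d\<close>;
  \<open>v\<close> is a center of the first, and every center of the second is a center of \<open>G\<close>.
\<close>

section \<open>Radii and centers expressed by inclusion in balls\<close>

text \<open>Boundedness makes the supremum a genuine least upper bound. From here on, radii are
  handled through inclusions in balls.\<close>

lemma far_radius_le_iff:
  assumes "F \<noteq> {}" "bounded F"
  shows "far_radius x F \<le> r \<longleftrightarrow> F \<subseteq> cball x r"
proof -
  obtain b where b: "\<And>a. a \<in> F \<Longrightarrow> norm a \<le> b"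
    using \<open>bounded F\<close> unfolding bounded_iff by blast
  have "bdd_above ((\<lambda>a. norm (x - a)) ` F)"
    by (rule bdd_aboveI2[where M = "norm x + b"])
      (use b norm_triangle_ineq4 add_left_mono order_trans in blast)
  then have "far_radius x F \<le> r \<longleftrightarrow> (\<forall>a\<in>F. norm (x - a) \<le> r)"
    unfolding far_radius_def using \<open>F \<noteq> {}\<close> by (rule cSUP_le_iff[rotated])
  then show ?thesis
    by (auto simp: dist_norm)
qed

text \<open>A ball of negative radius is empty and cannot contain \<open>F\<close>. This bounds from
  below the family whose infimum is \<open>restricted_radius\<close>.\<close>

lemma far_radius_nonneg:
  assumes "F \<noteq> {}" "bounded F"
  shows "0 \<le> far_radius x F"
proof -
  have "F \<subseteq> cball x (far_radius x F)"
    using far_radius_le_iff[OF assms] by blast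
  with \<open>F \<noteq> {}\<close> show ?thesis
    by (metis cball_eq_empty not_le subset_empty)
qed

lemma restricted_radius_le:
  assumes "F \<noteq> {}" "bounded F" "v \<in> V" "F \<subseteq> cball v r"
  shows "restricted_radius V F \<le> r"
proof -
  have "bdd_below ((\<lambda>v. far_radius v F) ` V)"
    by (rule bdd_belowI2[where m = 0]) (rule far_radius_nonneg[OF assms(1,2)])
  then have "restricted_radius V F \<le> far_radius v F"
    unfolding restricted_radius_def using \<open>v \<in> V\<close> by (rule cINF_lower)
  also have "\<dots> \<le> r"
    using assms far_radius_le_iff by blast
  finally show ?thesis .
qed

lemma restricted_radius_ge:
  assumes "F \<noteq> {}" "bounded F" "V \<noteq> {}"
    and "\<And>v t. v \<in> V \<Longrightarrow> F \<subseteq> cball v t \<Longrightarrow> r \<le> t"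
  shows "r \<le> restricted_radius V F"
  unfolding restricted_radius_def
  using assms(3) by (rule cINF_greatest) (use assms far_radius_le_iff in blast)

lemma restricted_radius_lessE:
  assumes "F \<noteq> {}" "bounded F" "V \<noteq> {}" "restricted_radius V F < t"
  obtains v where "v \<in> V" "F \<subseteq> cball v t"
proof -
  have "bdd_below ((\<lambda>v. far_radius v F) ` V)"
    by (rule bdd_belowI2[where m = 0]) (rule far_radius_nonneg[OF assms(1,2)])
  then obtain v where "v \<in> V" "far_radius v F < t"
    using assms(4) cINF_less_iff[OF assms(3)] unfolding restricted_radius_def by blast
  with that show thesis
    using far_radius_le_iff[OF assms(1,2)] less_imp_le by blast
qed

lemma near_center_set_eq:
  assumes "F \<noteq> {}" "bounded F"
  shows "near_center_set V F \<delta> = {v \<in> V. F \<subseteq> cball v (restricted_radius V F + \<delta>)}"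
  unfolding near_center_set_def using far_radius_le_iff[OF assms] by blast

text \<open>No point of \<open>V\<close> has radius below the infimum, so the equation defining a
  center amounts to an inequality.\<close>

lemma center_set_eq:
  assumes "F \<noteq> {}" "bounded F"
  shows "center_set V F = {v \<in> V. F \<subseteq> cball v (restricted_radius V F)}"
proof -
  have "far_radius v F = restricted_radius V F \<longleftrightarrow> F \<subseteq> cball v (restricted_radius V F)"
    if "v \<in> V" for v
    using restricted_radius_le[OF assms that] far_radius_le_iff[OF assms] order_antisym
    by (metis order_refl)
  then show ?thesis
    unfolding center_set_def by blast
qed

section \<open>The Hausdorff metric in terms of distances between points\<close>

lemma mem_set_plus_scaled_ball_iff:
  fixes A :: "'a::real_normed_vector set"
  assumes "r > 0"
  shows "x \<in> A + (*\<^sub>R) r ` cball 0 1 \<longleftrightarrow> (\<exists>a\<in>A. dist x a \<le> r)"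
proof -
  have ball: "(*\<^sub>R) r ` cball 0 1 = (cball 0 r :: 'a set)"
    using assms cball_scale[of r "0::'a" 1] by simp
  show ?thesis
    unfolding ball
  proof
    assume "x \<in> A + cball 0 r"
    then show "\<exists>a\<in>A. dist x a \<le> r"
      by (force elim!: set_plus_elim simp: dist_norm)
  next
    assume "\<exists>a\<in>A. dist x a \<le> r"
    then obtain a where "a \<in> A" "x - a \<in> cball 0 r"
      by (auto simp: dist_norm norm_minus_commute)
    then have "a + (x - a) \<in> A + cball 0 r"
      by (rule set_plus_intro)
    then show "x \<in> A + cball 0 r"
      by simp
  qed
qed

lemma Hausdorff_metric_le:
  fixes A B :: "'a::real_normed_vector set"
  assumes "r > 0"
    and "\<And>a. a \<in> A \<Longrightarrow> \<exists>b\<in>B. dist a b \<le> r"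
    and "\<And>b. b \<in> B \<Longrightarrow> \<exists>a\<in>A. dist b a \<le> r"
  shows "Hausdorff_metric A B \<le> r"
  unfolding Hausdorff_metric_def
proof (rule cInf_lower)
  show "bdd_below {r. 0 < r \<and> A \<subseteq> B + (*\<^sub>R) r ` cball 0 1 \<and> B \<subseteq> A + (*\<^sub>R) r ` cball 0 1}"
    by (rule bdd_belowI[where m = 0]) simp
qed (use assms in \<open>simp add: subset_iff mem_set_plus_scaled_ball_iff\<close>)

text \<open>The infimum need not be attained, but some admissible radius lies below
  \<open>r\<close>, and both conditions survive enlarging it to \<open>r\<close>.\<close>

lemma Hausdorff_metric_lessD:
  fixes A B :: "'a::real_normed_vector set"
  assumes "A \<in> CB" "B \<in> CB" "Hausdorff_metric A B < r"
  shows "\<And>a. a \<in> A \<Longrightarrow> \<exists>b\<in>B. dist a b \<le> r"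
    and "\<And>b. b \<in> B \<Longrightarrow> \<exists>a\<in>A. dist b a \<le> r"
proof -
  let ?S = "{r. 0 < r \<and> A \<subseteq> B + (*\<^sub>R) r ` cball 0 1 \<and> B \<subseteq> A + (*\<^sub>R) r ` cball 0 1}"
  obtain a0 b0 where a0: "a0 \<in> A" and b0: "b0 \<in> B"
    using assms by (auto simp: CB_def)
  have "bounded (A \<union> B)"
    using assms by (simp add: CB_def)
  then obtain t where t: "\<And>x y. x \<in> A \<union> B \<Longrightarrow> y \<in> A \<union> B \<Longrightarrow> dist x y \<le> t"
    unfolding bounded_two_points by blast
  have t': "\<And>x y. x \<in> A \<union> B \<Longrightarrow> y \<in> A \<union> B \<Longrightarrow> dist x y \<le> max t 1"
    using t by (meson max.coboundedI1)
  \<comment> \<open>The infimum is informative only if some radius is admissible; the maximum with 1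
    makes the diameter bound positive.\<close>
  have "max t 1 \<in> ?S"
    using t' a0 b0 by (auto simp: subset_iff mem_set_plus_scaled_ball_iff)
  moreover have "bdd_below ?S"
    by (rule bdd_belowI[where m = 0]) simp
  ultimately obtain s where "s \<in> ?S" "s < r"
    using assms(3) cInf_less_iff[of ?S r] unfolding Hausdorff_metric_def by blast
  then have *: "(\<forall>a\<in>A. \<exists>b\<in>B. dist a b \<le> s) \<and> (\<forall>b\<in>B. \<exists>a\<in>A. dist b a \<le> s)"
    by (auto simp: subset_iff mem_set_plus_scaled_ball_iff)
  show "\<And>a. a \<in> A \<Longrightarrow> \<exists>b\<in>B. dist a b \<le> r"
    and "\<And>b. b \<in> B \<Longrightarrow> \<exists>a\<in>A. dist b a \<le> r"
    using * \<open>s < r\<close> by (meson less_imp_le order_trans)+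
qed

section \<open>From property (P2) to uniform Hausdorff continuity\<close>

lemma property_P2_iff:
  assumes "\<F> \<subseteq> CB"
  shows "property_P2 V \<F> \<longleftrightarrow>
    (\<forall>G\<in>\<F>. center_set V G \<noteq> {}) \<and>
    (\<forall>\<epsilon>>0. \<exists>\<delta>>0. \<forall>G\<in>\<F>. \<forall>u\<in>V. G \<subseteq> cball u (restricted_radius V G + \<delta>) \<longrightarrow>
       (\<exists>w\<in>center_set V G. dist u w \<le> \<epsilon>))"
proof -
  have "near_center_set V G \<delta> \<subseteq> center_set V G + (*\<^sub>R) \<epsilon> ` cball 0 1 \<longleftrightarrow>
      (\<forall>u\<in>V. G \<subseteq> cball u (restricted_radius V G + \<delta>) \<longrightarrow> (\<exists>w\<in>center_set V G. dist u w \<le> \<epsilon>))"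
    if "G \<in> \<F>" "\<epsilon> > 0" for G \<epsilon> \<delta>
  proof -
    have "G \<noteq> {}" "bounded G"
      using that assms by (auto simp: CB_def)
    then show ?thesis
      using \<open>\<epsilon> > 0\<close> by (auto simp: near_center_set_eq subset_iff mem_set_plus_scaled_ball_iff)
  qed
  then have "(\<exists>\<delta>>0. \<forall>G\<in>\<F>. near_center_set V G \<delta> \<subseteq> center_set V G + (*\<^sub>R) \<epsilon> ` cball 0 1) \<longleftrightarrow>
      (\<exists>\<delta>>0. \<forall>G\<in>\<F>. \<forall>u\<in>V. G \<subseteq> cball u (restricted_radius V G + \<delta>) \<longrightarrow>
        (\<exists>w\<in>center_set V G. dist u w \<le> \<epsilon>))" if "\<epsilon> > 0" for \<epsilon>
    using that by simp
  then show ?thesis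
    unfolding property_P2_def by auto
qed

text \<open>The centers form the intersection of \<open>V\<close> with balls of one common radius
  about the points of \<open>F\<close>. It is closed and lies in any one of these balls.\<close>

lemma center_set_in_CB:
  assumes "F \<in> CB" "closed V" "center_set V F \<noteq> {}"
  shows "center_set V F \<in> CB"
proof -
  have F: "F \<noteq> {}" "bounded F"
    using assms by (auto simp: CB_def)
  obtain a where "a \<in> F"
    using F by blast
  have eq: "center_set V F = V \<inter> (\<Inter>x\<in>F. cball x (restricted_radius V F))"
    unfolding center_set_eq[OF F] by (auto simp: dist_commute)
  have "center_set V F \<subseteq> cball a (restricted_radius V F)"
    unfolding eq using \<open>a \<in> F\<close> by blast
  then have "bounded (center_set V F)"
    using bounded_cball bounded_subset by blast
  moreover have "closed (center_set V F)"
    unfolding eq using assms by (intro closed_Int closed_INT ballI closed_cball)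
  ultimately show ?thesis
    using assms(3) by (simp add: CB_def)
qed

text \<open>Enlarging by \<open>r\<close> a ball around one set makes it contain the other. This
  costs \<open>r\<close> when the restricted radii are compared and \<open>r\<close> again when
  \<open>z\<close> is used for \<open>B\<close>, hence \<open>2 * r\<close>.\<close>

lemma near_center_of_close_set:
  fixes A B :: "'a::real_normed_vector set"
  assumes "A \<in> CB" "B \<in> CB" and z: "z \<in> center_set V A"
    and "V \<noteq> {}"
    and AB: "\<And>a. a \<in> A \<Longrightarrow> \<exists>b\<in>B. dist a b \<le> r"
    and BA: "\<And>b. b \<in> B \<Longrightarrow> \<exists>a\<in>A. dist b a \<le> r"
  shows "B \<subseteq> cball z (restricted_radius V B + 2 * r)"
proof -
  have A: "A \<noteq> {}" "bounded A" and B: "B \<noteq> {}" "bounded B"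
    using assms by (auto simp: CB_def)
  have fatten: "S \<subseteq> cball v (t + r)"
    if T: "T \<subseteq> cball v t" and ST: "\<And>b. b \<in> S \<Longrightarrow> \<exists>a\<in>T. dist b a \<le> r" for S T :: "'a set" and v t
  proof
    fix b assume "b \<in> S"
    then obtain a where "a \<in> T" "dist b a \<le> r"
      using ST by blast
    moreover have "dist v a \<le> t"
      using T \<open>a \<in> T\<close> by auto
    ultimately show "b \<in> cball v (t + r)"
      using dist_triangle2[of v b a] by simp
  qed
  have "restricted_radius V A - r \<le> restricted_radius V B"
  proof (rule restricted_radius_ge[OF B \<open>V \<noteq> {}\<close>])
    fix v t assume "v \<in> V" "B \<subseteq> cball v t"
    then show "restricted_radius V A - r \<le> t"
      using restricted_radius_le[OF A \<open>v \<in> V\<close> fatten[of B v t A, OF _ AB]] by simp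
  qed
  moreover have "B \<subseteq> cball z (restricted_radius V A + r)"
    using z center_set_eq[OF A] by (intro fatten[OF _ BA]) auto
  ultimately show ?thesis
    by (auto simp: subset_iff intro: order_trans)
qed

text \<open>A center of one set is an almost-center of a nearby one, so the property supplies a
  center of the latter close by. Exchanging the sets gives the other half of the Hausdorff
  estimate.\<close>

lemma property_P2_imp_uniformly_Hausdorff_continuous_on:
  assumes "\<F> \<subseteq> CB" "closed V" "V \<noteq> {}" "property_P2 V \<F>"
  shows "uniformly_Hausdorff_continuous_on \<F> Hausdorff_metric (center_set V)"
  unfolding uniformly_Hausdorff_continuous_on_def
proof (intro conjI allI impI)
  have nonempty: "center_set V F \<noteq> {}" if "F \<in> \<F>" for F
    using assms(4) that unfolding property_P2_def by blast
  then show "center_set V ` \<F> \<subseteq> CB"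
    using assms(1,2) center_set_in_CB by blast
  fix \<epsilon> :: real assume "\<epsilon> > 0"
  then have "\<epsilon>/2 > 0"
    by simp
  from assms(4)[unfolded property_P2_iff[OF assms(1)], THEN conjunct2, rule_format, OF this]
  obtain d where "d > 0" and d: "\<And>G u. G \<in> \<F> \<Longrightarrow> u \<in> V \<Longrightarrow>
      G \<subseteq> cball u (restricted_radius V G + d) \<Longrightarrow> \<exists>w\<in>center_set V G. dist u w \<le> \<epsilon>/2"
    by blast
  have close: "\<exists>w\<in>center_set V B. dist z w \<le> \<epsilon>/2"
    if "A \<in> \<F>" "B \<in> \<F>" "z \<in> center_set V A"
      "\<And>a. a \<in> A \<Longrightarrow> \<exists>b\<in>B. dist a b \<le> d/2" "\<And>b. b \<in> B \<Longrightarrow> \<exists>a\<in>A. dist b a \<le> d/2" for A B z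
  proof (rule d[OF \<open>B \<in> \<F>\<close>])
    show "z \<in> V"
      using \<open>z \<in> center_set V A\<close> by (simp add: center_set_def)
    have "A \<in> CB" "B \<in> CB"
      using that assms(1) by auto
    from near_center_of_close_set[OF this that(3) assms(3) that(4,5)]
    show "B \<subseteq> cball z (restricted_radius V B + d)"
      by simp
  qed
  show "\<exists>\<delta>>0. \<forall>A\<in>\<F>. \<forall>B\<in>\<F>. Hausdorff_metric A B < \<delta> \<longrightarrow>
      Hausdorff_metric (center_set V A) (center_set V B) < \<epsilon>"
  \<comment> \<open>Comparing sets at distance \<open>d/2\<close> costs twice that, which is exactly
    the tolerance \<open>d\<close>. The bound \<open>\<epsilon>/2\<close> on the centers leaves room
    for the strict inequality.\<close>
  proof (intro exI[of _ "d/2"] conjI ballI impI)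
    fix A B assume AB: "A \<in> \<F>" "B \<in> \<F>" and H: "Hausdorff_metric A B < d/2"
    then have "A \<in> CB" "B \<in> CB"
      using assms(1) by auto
    note H' = Hausdorff_metric_lessD[OF this H]
    have "Hausdorff_metric (center_set V A) (center_set V B) \<le> \<epsilon>/2"
      using \<open>\<epsilon>/2 > 0\<close> close[OF AB _ H'] close[OF AB(2,1) _ H'(2,1)]
      by (rule Hausdorff_metric_le)
    with \<open>\<epsilon> > 0\<close> show "Hausdorff_metric (center_set V A) (center_set V B) < \<epsilon>"
      by simp
  qed (use \<open>d > 0\<close> in simp)
qed

section \<open>Quasi uniform rotundity, rescaled and made additive\<close>

text \<open>On the ray from \<open>u\<close> through \<open>g\<close> there is a point of
  \<open>cball g d\<close> at distance \<open>dist u g + d\<close> from \<open>u\<close>. If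
  \<open>g = u\<close>, no direction is distinguished and \<open>c\<close> provides one.\<close>

lemma dist_add_radius_le:
  fixes c g u :: "'a::real_normed_vector"
  assumes "c \<noteq> 0" "0 \<le> d" "cball g d \<subseteq> cball u t"
  shows "dist u g + d \<le> t"
proof (cases "g = u")
  case True
  have "g + (d / norm c) *\<^sub>R c \<in> cball g d"
    using assms(1,2) by (simp add: dist_norm)
  then have "g + (d / norm c) *\<^sub>R c \<in> cball u t"
    using assms(3) by blast
  then show ?thesis
    using assms(1,2) True by (simp add: dist_norm)
next
  case False
  let ?k = "d / norm (g - u)"
  have "g + ?k *\<^sub>R (g - u) \<in> cball g d"
    using assms(2) False by (simp add: dist_norm)
  then have "g + ?k *\<^sub>R (g - u) \<in> cball u t"
    using assms(3) by blast
  then have "norm (g + ?k *\<^sub>R (g - u) - u) \<le> t"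
    by (simp add: dist_norm norm_minus_commute)
  moreover have "g + ?k *\<^sub>R (g - u) - u = (1 + ?k) *\<^sub>R (g - u)"
    by (simp add: algebra_simps)
  ultimately have "\<bar>1 + ?k\<bar> * norm (g - u) \<le> t"
    by (metis norm_scaleR)
  moreover have "\<bar>1 + ?k\<bar> * norm (g - u) = norm (g - u) + d"
    using assms(2) False by (simp add: field_simps)
  ultimately show ?thesis
    by (simp add: dist_norm norm_minus_commute)
qed

text \<open>Translation by \<open>u\<close> and scaling by
  \<open>k = \<rho> / (1 - \<delta>)\<close> carry the radius \<open>1 - \<delta>\<close> to
  \<open>\<rho>\<close> and the unit ball to \<open>cball u k\<close>. The condition on
  \<open>s\<close> says precisely that \<open>s \<le> k\<close>.\<close>

lemma quasi_uniformly_rotund_scaled: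
  assumes Y: "subspace Y" "quasi_uniformly_rotund_wrt Y" and "\<epsilon> > 0"
  obtains \<delta> where "0 < \<delta>" "\<delta> < 1"
    "\<And>u v s \<rho>. u \<in> Y \<Longrightarrow> v \<in> Y \<Longrightarrow> 0 < \<rho> \<Longrightarrow> s * (1 - \<delta>) \<le> \<rho> \<Longrightarrow>
       \<exists>w\<in>Y. dist u w \<le> \<epsilon> * \<rho> \<and> cball u s \<inter> cball v \<rho> \<subseteq> cball w \<rho>"
proof (cases "Y = {0}")
  case True
  show ?thesis
    \<comment> \<open>All three points are 0. The case is split off because the tangency argument
      needs a nonzero vector of \<open>Y\<close>.\<close>
    by (rule that[of "1/2"]) (use True \<open>\<epsilon> > 0\<close> in auto)
next
  case False
  then obtain c where c: "c \<in> Y" "c \<noteq> 0"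
    using subspace_0[OF Y(1)] by blast
  \<comment> \<open>The cap \<open>1/2\<close> passes to \<open>\<delta>\<close> through
    \<open>\<delta> \<le> e\<close> and gives \<open>k \<le> 2 * \<rho>\<close>; the half of
    \<open>\<epsilon>\<close> absorbs this factor 2.\<close>
  define e where "e = min (\<epsilon>/2) (1/2)"
  have "e > 0"
    using \<open>\<epsilon> > 0\<close> by (simp add: e_def)
  then obtain \<delta> where \<delta>: "0 < \<delta>" "\<delta> < 1" and rotund:
    "\<And>v. v \<in> Y \<Longrightarrow> \<exists>w\<in>Y. w \<in> cball 0 e \<and> cball 0 1 \<inter> cball v (1 - \<delta>) \<subseteq> cball w (1 - \<delta>)"
    using Y(2) unfolding quasi_uniformly_rotund_wrt_def by blast
  \<comment> \<open>Internally tangent balls force \<open>w = v\<close>, so \<open>\<delta>\<close> cannot exceed \<open>e\<close>.\<close>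
  have "\<delta> \<le> e"
  proof -
    define v where "v = (\<delta> / norm c) *\<^sub>R c"
    have "v \<in> Y" "norm v = \<delta>"
      using c \<delta> Y(1) by (simp_all add: v_def subspace_scale)
    from rotund[OF \<open>v \<in> Y\<close>] obtain w where w: "w \<in> cball 0 e"
      "cball 0 1 \<inter> cball v (1 - \<delta>) \<subseteq> cball w (1 - \<delta>)"
      by blast
    have "cball v (1 - \<delta>) \<subseteq> cball 0 1"
    proof
      fix x assume "x \<in> cball v (1 - \<delta>)"
      then show "x \<in> cball 0 1"
        using norm_triangle_sub[of x v] \<open>norm v = \<delta>\<close> by (simp add: dist_norm norm_minus_commute)
    qed
    with w have "cball v (1 - \<delta>) \<subseteq> cball w (1 - \<delta>)"
      by blast
    then have "dist w v + (1 - \<delta>) \<le> 1 - \<delta>"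
      using \<delta> by (intro dist_add_radius_le[OF c(2)]) auto
    then have "w = v"
      by simp
    with w \<open>norm v = \<delta>\<close> show ?thesis
      by simp
  qed
  show ?thesis
  proof (rule that[OF \<delta>])
    fix u v and s \<rho> :: real
    assume uv: "u \<in> Y" "v \<in> Y" and "0 < \<rho>" and s: "s * (1 - \<delta>) \<le> \<rho>"
    define k where "k = \<rho> / (1 - \<delta>)"
    have k: "k > 0" "k * (1 - \<delta>) = \<rho>"
      using \<open>0 < \<rho>\<close> \<delta> by (simp_all add: k_def)
    have "s \<le> k"
      using s \<delta> by (simp add: k_def pos_le_divide_eq)
    have "(v - u) /\<^sub>R k \<in> Y"
      using uv Y(1) by (simp add: subspace_diff subspace_scale)
    from rotund[OF this] obtain w where w: "w \<in> Y" "norm w \<le> e"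
      "cball 0 1 \<inter> cball ((v - u) /\<^sub>R k) (1 - \<delta>) \<subseteq> cball w (1 - \<delta>)"
      by auto
    have scaled: "norm (a /\<^sub>R k) \<le> 1 - \<delta> \<longleftrightarrow> norm a \<le> \<rho>" for a :: 'a
      using k(1) by (simp add: k(2)[symmetric] pos_divide_le_eq divide_inverse_commute[symmetric] mult.commute)
    show "\<exists>w\<in>Y. dist u w \<le> \<epsilon> * \<rho> \<and> cball u s \<inter> cball v \<rho> \<subseteq> cball w \<rho>"
    proof (intro bexI conjI subsetI)
      show "u + k *\<^sub>R w \<in> Y"
        using uv w Y(1) by (simp add: subspace_add subspace_scale)
      have "k * norm w \<le> k * e"
        using w k by simp
      also have "\<dots> \<le> (2 * \<rho>) * (\<epsilon>/2)"
      proof (rule mult_mono)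
        have "1 - \<delta> \<ge> 1/2"
          using \<open>\<delta> \<le> e\<close> by (simp add: e_def)
        then have "k * (1/2) \<le> k * (1 - \<delta>)"
          using k(1) by (intro mult_left_mono) auto
        then show "k \<le> 2 * \<rho>"
          using k(2) by simp
      qed (use \<open>0 < \<rho>\<close> \<open>e > 0\<close> in \<open>auto simp: e_def\<close>)
      finally show "dist u (u + k *\<^sub>R w) \<le> \<epsilon> * \<rho>"
        using k by (simp add: dist_norm mult.commute)
      fix x assume "x \<in> cball u s \<inter> cball v \<rho>"
      then have x: "norm (x - u) \<le> k" "norm (v - x) \<le> \<rho>"
        using \<open>s \<le> k\<close> by (auto simp: dist_norm norm_minus_commute)
      have "(x - u) /\<^sub>R k \<in> cball 0 1"
        using x k(1) by (simp add: divide_inverse_commute[symmetric])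
      moreover have "(v - u) /\<^sub>R k - (x - u) /\<^sub>R k = (v - x) /\<^sub>R k"
        by (simp add: algebra_simps)
      then have "(x - u) /\<^sub>R k \<in> cball ((v - u) /\<^sub>R k) (1 - \<delta>)"
        using x scaled by (simp only: mem_cball dist_norm)
      ultimately have "(x - u) /\<^sub>R k \<in> cball w (1 - \<delta>)"
        using w(3) by blast
      moreover have "w - (x - u) /\<^sub>R k = (u + k *\<^sub>R w - x) /\<^sub>R k"
        using k by (simp add: algebra_simps)
      ultimately show "x \<in> cball (u + k *\<^sub>R w) \<rho>"
        using scaled by (simp only: mem_cball dist_norm)
    qed
  qed
qed

text \<open>The multiplicative slack \<open>\<rho> * \<delta>\<close> degenerates as
  \<open>\<rho>\<close> tends to 0, so small radii are treated apart: there, two balls that meet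
  have centers so close that \<open>w = v\<close> works. For \<open>\<rho>\<close> bounded away from
  0, an additive slack is dominated by the multiplicative one.\<close>

lemma quasi_uniformly_rotund_additive:
  assumes Y: "subspace Y" "quasi_uniformly_rotund_wrt Y" and "\<epsilon> > 0" "M > 0"
  obtains \<delta> where "0 < \<delta>"
    "\<And>u v s \<rho>. u \<in> Y \<Longrightarrow> v \<in> Y \<Longrightarrow> \<rho> \<le> M \<Longrightarrow> s \<le> \<rho> + \<delta> \<Longrightarrow>
       \<exists>w\<in>Y. dist u w \<le> \<epsilon> \<and> cball u s \<inter> cball v \<rho> \<subseteq> cball w \<rho>"
proof -
  have "\<epsilon> / M > 0"
    using assms by simp
  then obtain \<delta> where \<delta>: "0 < \<delta>" "\<delta> < 1" and rotund:
    "\<And>u v s \<rho>. u \<in> Y \<Longrightarrow> v \<in> Y \<Longrightarrow> 0 < \<rho> \<Longrightarrow> s * (1 - \<delta>) \<le> \<rho> \<Longrightarrow>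
       \<exists>w\<in>Y. dist u w \<le> \<epsilon> / M * \<rho> \<and> cball u s \<inter> cball v \<rho> \<subseteq> cball w \<rho>"
    using quasi_uniformly_rotund_scaled[OF Y] by blast
  \<comment> \<open>For \<open>\<rho> < c\<close> the centers of balls that meet are at distance at
    most \<open>s + \<rho> \<le> 2 * \<rho> + c * \<delta> < 3 * c\<close>.\<close>
  define c where "c = \<epsilon> / 3"
  have "c > 0"
    using \<open>\<epsilon> > 0\<close> by (simp add: c_def)
  show thesis
  proof (rule that)
    show "0 < c * \<delta>"
      using \<open>c > 0\<close> \<delta> by simp
    fix u v and s \<rho> :: real
    assume uv: "u \<in> Y" "v \<in> Y" and "\<rho> \<le> M" and s: "s \<le> \<rho> + c * \<delta>"
    show "\<exists>w\<in>Y. dist u w \<le> \<epsilon> \<and> cball u s \<inter> cball v \<rho> \<subseteq> cball w \<rho>"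
    proof (cases "\<rho> < c")
      case True
      show ?thesis
      proof (cases "cball u s \<inter> cball v \<rho> = {}")
        case True
        then show ?thesis
          using uv \<open>\<epsilon> > 0\<close> by (intro bexI[of _ u]) auto
      next
        case False
        then obtain x where "dist u x \<le> s" "dist v x \<le> \<rho>"
          by auto
        then have "dist u v \<le> s + \<rho>"
          using dist_triangle2[of u v x] by simp
        moreover have "c * \<delta> \<le> c"
          using \<open>c > 0\<close> \<delta> by simp
        ultimately have "dist u v \<le> \<epsilon>"
          using s True by (simp add: c_def)
        then show ?thesis
          using uv by (intro bexI[of _ v]) auto
      qed
    next
      case False
      then have "0 < \<rho>" "c * \<delta> \<le> \<rho> * \<delta>"
        using \<open>c > 0\<close> \<delta> by simp_all
      then have "s \<le> \<rho> + \<rho> * \<delta>"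
        using s by linarith
      then have "s * (1 - \<delta>) \<le> (\<rho> + \<rho> * \<delta>) * (1 - \<delta>)"
        using \<delta> by (intro mult_right_mono) auto
      also have "\<dots> = \<rho> - \<rho> * \<delta>\<^sup>2"
        by (simp add: algebra_simps power2_eq_square)
      also have "\<dots> \<le> \<rho>"
        using \<open>0 < \<rho>\<close> by simp
      finally obtain w where "w \<in> Y" "dist u w \<le> \<epsilon> / M * \<rho>" "cball u s \<inter> cball v \<rho> \<subseteq> cball w \<rho>"
        using rotund[OF uv \<open>0 < \<rho>\<close>] by blast
      moreover have "\<epsilon> / M * \<rho> \<le> \<epsilon> / M * M"
        using \<open>\<rho> \<le> M\<close> \<open>\<epsilon> / M > 0\<close> by (intro mult_left_mono) auto
      ultimately show ?thesis
        using \<open>M > 0\<close> by (intro bexI[of _ w]) auto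
    qed
  qed
qed

section \<open>From almost-centers to centers by successive approximation\<close>

text \<open>Stage \<open>n\<close> moves the current point by at most
  \<open>\<epsilon> / 2 ^ Suc n\<close> and lowers its excess over the restricted radius from
  \<open>d n\<close> to \<open>d (Suc n)\<close>. The moves sum to at most
  \<open>\<epsilon>\<close>, and the limit, which exists by completeness and lies in the closed set
  \<open>Y\<close>, has no excess. The tolerance \<open>d 0\<close> is chosen before
  \<open>F\<close>, hence uniform.\<close>

lemma center_near_almost_center:
  fixes Y :: "'a::banach set"
  assumes Y: "subspace Y" "closed Y" "quasi_uniformly_rotund_wrt Y" and "\<epsilon> > 0" "\<alpha> > 0"
  obtains \<delta> where "0 < \<delta>"
    "\<And>F u. F \<in> CB \<Longrightarrow> restricted_radius Y F \<le> \<alpha> \<Longrightarrow> u \<in> Y \<Longrightarrow>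
       F \<subseteq> cball u (restricted_radius Y F + \<delta>) \<Longrightarrow> \<exists>w\<in>center_set Y F. dist u w \<le> \<epsilon>"
proof -
  \<comment> \<open>All radii reached are at most \<open>\<alpha> + d n\<close>, and every
    \<open>d n\<close> is at most 1.\<close>
  have "\<alpha> + 1 > 0"
    using \<open>\<alpha> > 0\<close> by simp
  have "\<exists>\<delta>>0. \<forall>u\<in>Y. \<forall>v\<in>Y. \<forall>s \<rho>. \<rho> \<le> \<alpha> + 1 \<longrightarrow> s \<le> \<rho> + \<delta> \<longrightarrow>
       (\<exists>w\<in>Y. dist u w \<le> \<epsilon> / 2 ^ Suc n \<and> cball u s \<inter> cball v \<rho> \<subseteq> cball w \<rho>)" for n :: nat
  proof -
    have "\<epsilon> / 2 ^ Suc n > 0"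
      using \<open>\<epsilon> > 0\<close> by simp
    from quasi_uniformly_rotund_additive[OF Y(1,3) this \<open>\<alpha> + 1 > 0\<close>] show ?thesis
      by metis
  qed
  then obtain D where D_pos: "\<And>n. D n > 0" and D: "\<And>n u v s \<rho>. u \<in> Y \<Longrightarrow> v \<in> Y \<Longrightarrow>
      \<rho> \<le> \<alpha> + 1 \<Longrightarrow> s \<le> \<rho> + D n \<Longrightarrow>
      \<exists>w\<in>Y. dist u w \<le> \<epsilon> / 2 ^ Suc n \<and> cball u s \<inter> cball v \<rho> \<subseteq> cball w \<rho>"
    by metis
  \<comment> \<open>\<open>D n\<close> is the excess that one stage can remove; the power of
    \<open>1/2\<close> forces the excesses to 0.\<close>
  define d where "d n = min (D n) ((1/2) ^ n)" for n
  have d_pos: "d n > 0" for n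
    using D_pos by (simp add: d_def)
  have d_le_1: "d n \<le> 1" for n
    by (simp add: d_def min.coboundedI2 power_le_one)
  have d_lim: "d \<longlonglongrightarrow> 0"
  proof (rule tendsto_sandwich[OF _ _ tendsto_const])
    show "(\<lambda>n. (1/2) ^ n :: real) \<longlonglongrightarrow> 0"
      by (rule LIMSEQ_power_zero) simp
  qed (simp_all add: d_def less_imp_le[OF D_pos])
  show thesis
  proof (rule that[OF d_pos[of 0]])
    fix F :: "'a set" and u0
    let ?R = "restricted_radius Y F"
    assume "F \<in> CB" and R: "?R \<le> \<alpha>" and u0: "u0 \<in> Y" "F \<subseteq> cball u0 (?R + d 0)"
    have F: "F \<noteq> {}" "bounded F"
      using \<open>F \<in> CB\<close> by (auto simp: CB_def)
    \<comment> \<open>The last clause pins the start: dependent choice by itself only returns some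
      point satisfying the predicate at 0.\<close>
    let ?P = "\<lambda>n u. u \<in> Y \<and> F \<subseteq> cball u (?R + d n) \<and> (n = 0 \<longrightarrow> u = u0)"
    have step: "\<exists>u'. ?P (Suc n) u' \<and> dist u u' \<le> \<epsilon> / 2 ^ Suc n" if u: "?P n u" for n u
    proof -
      have "Y \<noteq> {}" "?R < ?R + d (Suc n)"
        using u0 d_pos by auto
      \<comment> \<open>This almost-center may be far from \<open>u\<close>; rotundity replaces it
        by one near \<open>u\<close> whose ball contains the intersection of both balls, hence
        \<open>F\<close>.\<close>
      with F obtain v where v: "v \<in> Y" "F \<subseteq> cball v (?R + d (Suc n))"
        using restricted_radius_lessE by blast
      have "?R + d (Suc n) \<le> \<alpha> + 1"
        using R d_le_1 by (intro add_mono) auto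
      moreover have "?R + d n \<le> ?R + d (Suc n) + D n"
        using d_pos[of "Suc n"] by (simp add: d_def min.coboundedI1)
      ultimately obtain w where "w \<in> Y" "dist u w \<le> \<epsilon> / 2 ^ Suc n"
        "cball u (?R + d n) \<inter> cball v (?R + d (Suc n)) \<subseteq> cball w (?R + d (Suc n))"
        using D u v by blast
      with u v show ?thesis
        by (intro exI[of _ w]) auto
    qed
    have "\<exists>u. ?P 0 u"
      using u0 by blast
    from dependent_nat_choice[of ?P "\<lambda>n u u'. dist u u' \<le> \<epsilon> / 2 ^ Suc n", OF this step]
    obtain f where "\<forall>n. ?P n (f n) \<and> dist (f n) (f (Suc n)) \<le> \<epsilon> / 2 ^ Suc n"
      by (rule exE)
    then have f: "?P n (f n)" "dist (f n) (f (Suc n)) \<le> \<epsilon> / 2 ^ Suc n" for n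
      by blast+
    \<comment> \<open>The right side is the exact geometric sum of the moves, so the induction
      closes.\<close>
    have dist_f: "dist (f m) (f (m + k)) \<le> \<epsilon> / 2 ^ m - \<epsilon> / 2 ^ (m + k)" for m k
    proof (induction k)
      case (Suc k)
      have "\<epsilon> / 2 ^ (m + k) - \<epsilon> / 2 ^ Suc (m + k) = \<epsilon> / 2 ^ Suc (m + k)"
        by (simp add: field_simps)
      with Suc f(2)[of "m + k"] dist_triangle[of "f m" "f (m + Suc k)" "f (m + k)"] show ?case
        by simp
    qed simp
    have "Cauchy f"
      unfolding Cauchy_altdef2
    proof (intro allI impI)
      fix e :: real assume "e > 0"
      have "(\<lambda>n. \<epsilon> * (1/2) ^ n) \<longlonglongrightarrow> \<epsilon> * 0"
        by (intro tendsto_mult tendsto_const LIMSEQ_power_zero) simp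
      then have "\<forall>\<^sub>F n in sequentially. \<epsilon> * (1/2) ^ n < e"
        using \<open>e > 0\<close> order_tendstoD(2) by fastforce
      then obtain N where N: "\<epsilon> / 2 ^ N < e"
        by (auto simp: eventually_sequentially power_divide)
      have "dist (f n) (f N) < e" if "n \<ge> N" for n
      proof -
        have "dist (f N) (f n) \<le> \<epsilon> / 2 ^ N - \<epsilon> / 2 ^ n"
          using dist_f[of N "n - N"] that by simp
        moreover have "\<epsilon> / 2 ^ n > 0"
          using \<open>\<epsilon> > 0\<close> by simp
        ultimately show ?thesis
          using N by (simp add: dist_commute)
      qed
      then show "\<exists>N. \<forall>n\<ge>N. dist (f n) (f N) < e"
        by blast
    qed
    then obtain w where w: "f \<longlonglongrightarrow> w"
      using Cauchy_convergent_iff convergent_def by blast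
    show "\<exists>w\<in>center_set Y F. dist u0 w \<le> \<epsilon>"
    proof (intro bexI)
      have "dist u0 (f n) \<le> \<epsilon>" for n
      proof -
        have "\<epsilon> / 2 ^ n > 0"
          using \<open>\<epsilon> > 0\<close> by simp
        then show ?thesis
          using dist_f[of 0 n] f(1)[of 0] by simp
      qed
      then show "dist u0 w \<le> \<epsilon>"
        by (intro LIMSEQ_le_const2[OF tendsto_dist[OF tendsto_const w]]) auto
      have "dist w x \<le> ?R" if "x \<in> F" for x
      proof (rule LIMSEQ_le)
        show "(\<lambda>n. dist (f n) x) \<longlonglongrightarrow> dist w x"
          by (intro tendsto_dist w tendsto_const)
        show "(\<lambda>n. ?R + d n) \<longlonglongrightarrow> ?R"
          using tendsto_add[OF tendsto_const d_lim] by simp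
        show "\<exists>N. \<forall>n\<ge>N. dist (f n) x \<le> ?R + d n"
          using f(1) that by (meson mem_cball subsetD)
      qed
      moreover have "w \<in> Y"
        using closed_sequentially[OF Y(2) _ w] f(1) by blast
      ultimately show "w \<in> center_set Y F"
        by (auto simp: center_set_eq[OF F])
    qed
  qed
qed

text \<open>Centers exist because almost-centers do: any tolerance, here 1, turns an almost-center
  into a center.\<close>

lemma quasi_uniformly_rotund_imp_property_P2:
  fixes Y :: "'a::banach set"
  assumes Y: "subspace Y" "closed Y" "quasi_uniformly_rotund_wrt Y" and "\<alpha> > 0"
  shows "property_P2 Y {F \<in> CB. restricted_radius Y F \<le> \<alpha>}" (is "property_P2 Y ?\<F>")
proof -
  have "?\<F> \<subseteq> CB"
    by blast
  moreover have "center_set Y F \<noteq> {}" if F: "F \<in> ?\<F>" for F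
  proof -
    obtain \<delta> where "\<delta> > 0" and \<delta>: "\<And>u. u \<in> Y \<Longrightarrow>
        F \<subseteq> cball u (restricted_radius Y F + \<delta>) \<Longrightarrow> \<exists>w\<in>center_set Y F. dist u w \<le> 1"
      using center_near_almost_center[OF Y zero_less_one \<open>\<alpha> > 0\<close>] F
      by (metis (mono_tags, lifting) mem_Collect_eq)
    have "F \<noteq> {}" "bounded F" "Y \<noteq> {}"
      using F subspace_0[OF Y(1)] by (auto simp: CB_def)
    moreover have "restricted_radius Y F < restricted_radius Y F + \<delta>"
      using \<open>\<delta> > 0\<close> by simp
    ultimately obtain u where "u \<in> Y" "F \<subseteq> cball u (restricted_radius Y F + \<delta>)"
      using restricted_radius_lessE by blast
    with \<delta> show ?thesis
      by blast
  qed
  moreover have "\<exists>\<delta>>0. \<forall>F\<in>?\<F>. \<forall>u\<in>Y. F \<subseteq> cball u (restricted_radius Y F + \<delta>) \<longrightarrow>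
       (\<exists>w\<in>center_set Y F. dist u w \<le> \<epsilon>)" if "\<epsilon> > 0" for \<epsilon>
    using center_near_almost_center[OF Y that \<open>\<alpha> > 0\<close>] by (metis (mono_tags, lifting) mem_Collect_eq)
  ultimately show ?thesis
    using property_P2_iff by blast
qed

section \<open>From property (P2) to quasi uniform rotundity\<close>

text \<open>The argument is run in the ball of radius \<open>\<alpha>\<close> and scaled back at the
  end, so that each nonempty intersection \<open>G\<close> has restricted radius at most
  \<open>\<alpha> * (1 - \<delta>)\<close> and belongs to the class.\<close>

lemma property_P2_imp_quasi_uniformly_rotund:
  fixes Y :: "'a::real_normed_vector set"
  assumes Y: "subspace Y" and "\<alpha> > 0"
    and P2: "property_P2 Y {F \<in> CB. restricted_radius Y F \<le> \<alpha>}" (is "property_P2 Y ?\<F>")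
  shows "quasi_uniformly_rotund_wrt Y"
  unfolding quasi_uniformly_rotund_wrt_def
proof (intro allI impI)
  fix \<epsilon> :: real assume "\<epsilon> > 0"
  then have "\<alpha> * \<epsilon> > 0"
    using \<open>\<alpha> > 0\<close> by simp
  have "?\<F> \<subseteq> CB"
    by blast
  note P2' = P2[unfolded property_P2_iff[OF this]]
  from P2'[THEN conjunct2, rule_format, OF \<open>\<alpha> * \<epsilon> > 0\<close>]
  obtain D where "D > 0" and D: "\<And>G u. G \<in> ?\<F> \<Longrightarrow> u \<in> Y \<Longrightarrow>
      G \<subseteq> cball u (restricted_radius Y G + D) \<Longrightarrow> \<exists>w\<in>center_set Y G. dist u w \<le> \<alpha> * \<epsilon>"
    by blast
  \<comment> \<open>The second bound keeps the step \<open>t\<close> taken later within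
    \<open>2 * t \<le> \<epsilon>\<close>; a center has norm at most \<open>2 * \<alpha>\<close>, so
    the displacement stays below \<open>\<alpha> * \<epsilon>\<close>.\<close>
  define \<delta> where "\<delta> = min (1/2) (\<epsilon> * D / (2 * \<alpha>))"
  have \<delta>: "0 < \<delta>" "\<delta> < 1" "2 * \<alpha> * \<delta> \<le> \<epsilon> * D"
  proof -
    show "0 < \<delta>" "\<delta> < 1"
      using \<open>\<epsilon> > 0\<close> \<open>D > 0\<close> \<open>\<alpha> > 0\<close> by (auto simp: \<delta>_def)
    have "\<delta> \<le> \<epsilon> * D / (2 * \<alpha>)"
      by (simp add: \<delta>_def)
    then show "2 * \<alpha> * \<delta> \<le> \<epsilon> * D"
      using \<open>\<alpha> > 0\<close> by (simp add: pos_le_divide_eq mult.commute)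
  qed
  have scaled: "\<exists>w\<in>Y. dist 0 w \<le> \<alpha> * \<epsilon> \<and> G \<subseteq> cball w (\<alpha> * (1 - \<delta>))"
    if v: "v \<in> Y" and G_def: "G = cball 0 \<alpha> \<inter> cball v (\<alpha> * (1 - \<delta>))" for v G
  proof (cases "G = {}")
    case True
    then show ?thesis
      using \<open>\<alpha> * \<epsilon> > 0\<close> subspace_0[OF Y] by (intro bexI[of _ 0]) auto
  next
    case False
    let ?R = "restricted_radius Y G"
    have G: "G \<noteq> {}" "bounded G"
      using False by (auto simp: G_def bounded_Int)
    have R: "?R \<le> \<alpha> * (1 - \<delta>)"
      using v by (intro restricted_radius_le[OF G]) (auto simp: G_def)
    have "\<alpha> * (1 - \<delta>) \<le> \<alpha>"
      using \<open>\<alpha> > 0\<close> \<delta> by simp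
    with R have "G \<in> ?\<F>"
      using G by (auto simp: CB_def G_def)
    show ?thesis
    \<comment> \<open>In the first case 0 itself is an almost-center of \<open>G\<close>, so a
      center lies within \<open>\<alpha> * \<epsilon>\<close> of it.\<close>
    proof (cases "\<alpha> \<le> ?R + D")
      case True
      then have "G \<subseteq> cball 0 (?R + D)"
        by (auto simp: G_def)
      with D[OF \<open>G \<in> ?\<F>\<close> subspace_0[OF Y]] obtain w where "w \<in> center_set Y G" "dist 0 w \<le> \<alpha> * \<epsilon>"
        by blast
      moreover have "cball w ?R \<subseteq> cball w (\<alpha> * (1 - \<delta>))"
        using R by (rule subset_cball)
      ultimately show ?thesis
        unfolding center_set_eq[OF G] by blast
    next
      case False
      obtain u where u: "u \<in> Y" "G \<subseteq> cball u ?R"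
        using P2'[THEN conjunct1, rule_format, OF \<open>G \<in> ?\<F>\<close>]
        by (auto simp: center_set_eq[OF G])
      \<comment> \<open>Moving from \<open>0\<close> towards the center \<open>u\<close> decreases the radius at rate at least
        \<open>\<alpha> - ?R > D\<close>, so a short step suffices.\<close>
      define t where "t = \<alpha> * \<delta> / (\<alpha> - ?R)"
      have "\<alpha> - ?R > D"
        using False by simp
      then have t: "t * (\<alpha> - ?R) = \<alpha> * \<delta>" "0 \<le> t"
        using \<open>\<alpha> > 0\<close> \<open>D > 0\<close> \<delta> by (simp_all add: t_def)
      have "t \<le> 1"
        using R \<open>\<alpha> - ?R > D\<close> \<open>D > 0\<close> by (simp add: t_def pos_divide_le_eq algebra_simps)
      show ?thesis
      proof (intro bexI conjI subsetI)
        show "t *\<^sub>R u \<in> Y"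
          using u Y by (simp add: subspace_scale)
        obtain x where "x \<in> G"
          using G by blast
        then have "norm x \<le> \<alpha>" "dist u x \<le> \<alpha>"
          using u(2) R \<open>\<alpha> * (1 - \<delta>) \<le> \<alpha>\<close> by (auto simp: G_def)
        then have "norm u \<le> 2 * \<alpha>"
          using norm_triangle_sub[of u x] by (simp add: dist_norm)
        have "t * D \<le> t * (\<alpha> - ?R)"
          using t \<open>\<alpha> - ?R > D\<close> by (intro mult_left_mono) auto
        also have "2 * \<dots> \<le> \<epsilon> * D"
          using t \<delta> by simp
        finally have "2 * t \<le> \<epsilon>"
          using \<open>D > 0\<close> by simp
        have "norm (t *\<^sub>R u) \<le> t * (2 * \<alpha>)"
          using t \<open>norm u \<le> 2 * \<alpha>\<close> by (simp add: mult_left_mono)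
        also have "\<dots> \<le> \<alpha> * \<epsilon>"
          using \<open>2 * t \<le> \<epsilon>\<close> \<open>\<alpha> > 0\<close> by simp
        finally show "dist 0 (t *\<^sub>R u) \<le> \<alpha> * \<epsilon>"
          by simp
        fix x assume "x \<in> G"
        then have x: "norm x \<le> \<alpha>" "norm (u - x) \<le> ?R"
          using u by (auto simp: G_def dist_norm)
        \<comment> \<open>Convexity of the norm: the weights \<open>t\<close> and
          \<open>1 - t\<close> combine the radii \<open>?R\<close> at \<open>u\<close> and
          \<open>\<alpha>\<close> at 0 into \<open>\<alpha> - t * (\<alpha> - ?R)\<close>, and
          \<open>t\<close> was chosen to make this \<open>\<alpha> * (1 - \<delta>)\<close>.\<close>
        have "t *\<^sub>R u - x = t *\<^sub>R (u - x) - (1 - t) *\<^sub>R x"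
          by (simp add: algebra_simps)
        then have "norm (t *\<^sub>R u - x) \<le> norm (t *\<^sub>R (u - x)) + norm ((1 - t) *\<^sub>R x)"
          using norm_triangle_ineq4 by metis
        also have "\<dots> \<le> t * ?R + (1 - t) * \<alpha>"
          using x t \<open>t \<le> 1\<close> by (intro add_mono) (auto intro: mult_left_mono)
        also have "\<dots> = \<alpha> * (1 - \<delta>)"
          using t(1) by (simp add: algebra_simps)
        finally show "x \<in> cball (t *\<^sub>R u) (\<alpha> * (1 - \<delta>))"
          by (simp add: dist_norm)
      qed
    qed
  qed
  have "\<exists>w\<in>Y. w \<in> cball 0 \<epsilon> \<and> cball 0 1 \<inter> cball v (1 - \<delta>) \<subseteq> cball w (1 - \<delta>)"
    if v: "v \<in> Y" for v
  proof -
    have dist_scaled: "dist (\<alpha> *\<^sub>R a) (\<alpha> *\<^sub>R b) \<le> \<alpha> * r \<longleftrightarrow> dist a b \<le> r" for a b :: 'a and r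
      using \<open>\<alpha> > 0\<close> by (simp add: dist_norm flip: scaleR_diff_right)
    have "\<alpha> *\<^sub>R v \<in> Y"
      using v Y by (simp add: subspace_scale)
    from scaled[OF this refl] obtain w where w: "w \<in> Y" "dist 0 w \<le> \<alpha> * \<epsilon>"
      "cball 0 \<alpha> \<inter> cball (\<alpha> *\<^sub>R v) (\<alpha> * (1 - \<delta>)) \<subseteq> cball w (\<alpha> * (1 - \<delta>))"
      by blast
    define w' where "w' = w /\<^sub>R \<alpha>"
    have w': "w = \<alpha> *\<^sub>R w'"
      using \<open>\<alpha> > 0\<close> by (simp add: w'_def)
    have "dist 0 w' \<le> \<epsilon>"
      using w(2) dist_scaled[of 0 w' \<epsilon>] by (simp add: w')
    moreover have "dist w' x \<le> 1 - \<delta>" if "dist 0 x \<le> 1" "dist v x \<le> 1 - \<delta>" for x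
    proof -
      have "\<alpha> *\<^sub>R x \<in> cball 0 \<alpha> \<inter> cball (\<alpha> *\<^sub>R v) (\<alpha> * (1 - \<delta>))"
        using that dist_scaled[of v x] dist_scaled[of 0 x 1] by simp
      then have "\<alpha> *\<^sub>R x \<in> cball w (\<alpha> * (1 - \<delta>))"
        using w(3) by blast
      then show ?thesis
        unfolding w' mem_cball dist_scaled .
    qed
    moreover have "w' \<in> Y"
      using w(1) Y by (simp add: w'_def subspace_scale)
    ultimately show ?thesis
      by (intro bexI[of _ w']) auto
  qed
  with \<delta> show "\<exists>\<delta>. 0 < \<delta> \<and> \<delta> < 1 \<and>
      (\<forall>v\<in>Y. \<exists>w\<in>Y. w \<in> cball 0 \<epsilon> \<and> cball 0 1 \<inter> cball v (1 - \<delta>) \<subseteq> cball w (1 - \<delta>))"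
    by blast
qed

section \<open>From uniform Hausdorff continuity to property (P2) at half the level\<close>

text \<open>Closures bring the sets constructed later into \<open>CB\<close>. A point of a closure
  is within \<open>r\<close> of the set itself, which doubles the bound.\<close>

lemma Hausdorff_metric_closure_le:
  fixes A B :: "'a::real_normed_vector set"
  assumes "r > 0"
    and "\<And>a. a \<in> A \<Longrightarrow> \<exists>b\<in>B. dist a b \<le> r"
    and "\<And>b. b \<in> B \<Longrightarrow> \<exists>a\<in>A. dist b a \<le> r"
  shows "Hausdorff_metric (closure A) (closure B) \<le> 2 * r"
proof -
  have approx: "\<exists>t\<in>closure T. dist x t \<le> 2 * r"
    if x: "x \<in> closure S" and S: "\<And>s. s \<in> S \<Longrightarrow> \<exists>t\<in>T. dist s t \<le> r" for S T :: "'a set" and x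
  proof -
    obtain s where "s \<in> S" "dist s x < r"
      using x \<open>r > 0\<close> closure_approachable by blast
    with S obtain t where "t \<in> T" "dist s t \<le> r"
      by blast
    then have "dist x t \<le> 2 * r"
      using \<open>dist s x < r\<close> dist_triangle3[of x t s] by simp
    then show ?thesis
      using \<open>t \<in> T\<close> closure_subset by blast
  qed
  show ?thesis
    using \<open>r > 0\<close> assms(2,3) by (intro Hausdorff_metric_le approx) auto
qed

lemma uniformly_Hausdorff_continuous_imp_property_P2:
  fixes Y :: "'a::real_normed_vector set"
  assumes Y: "subspace Y" and "\<alpha> > 0"
    and nonempty: "\<And>F. F \<in> CB \<Longrightarrow> restricted_radius Y F \<le> \<alpha> \<Longrightarrow> center_set Y F \<noteq> {}"
    and cont: "uniformly_Hausdorff_continuous_on {F \<in> CB. restricted_radius Y F \<le> \<alpha>}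
      Hausdorff_metric (center_set Y)"
  shows "property_P2 Y {F \<in> CB. restricted_radius Y F \<le> \<alpha>/2}" (is "property_P2 Y ?\<F>")
proof -
  have Y_ne: "Y \<noteq> {}"
    using subspace_0[OF Y] by blast
  have near: "\<exists>\<delta>>0. \<forall>G\<in>?\<F>. \<forall>v\<in>Y. G \<subseteq> cball v (restricted_radius Y G + \<delta>) \<longrightarrow>
       (\<exists>w\<in>center_set Y G. dist v w \<le> \<epsilon>)" if \<epsilon>: "\<epsilon> > 0" for \<epsilon>
  proof -
    obtain \<eta> where "\<eta> > 0" and \<eta>: "\<And>A B. A \<in> CB \<Longrightarrow> restricted_radius Y A \<le> \<alpha> \<Longrightarrow>
        B \<in> CB \<Longrightarrow> restricted_radius Y B \<le> \<alpha> \<Longrightarrow> Hausdorff_metric A B < \<eta> \<Longrightarrow>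
        Hausdorff_metric (center_set Y A) (center_set Y B) < \<epsilon>"
      using cont[unfolded uniformly_Hausdorff_continuous_on_def, THEN conjunct2, rule_format, OF \<epsilon>]
      by blast
    \<comment> \<open>The closures end up at distance at most \<open>2 * d < \<eta>\<close>, and
      their radii at most \<open>\<alpha>/2 + d \<le> \<alpha>\<close>, inside the domain of
      continuity. This is why \<open>G\<close> is taken at level \<open>\<alpha>/2\<close>.\<close>
    define d where "d = min (\<eta>/3) (\<alpha>/2)"
    have d: "0 < d" "2 * d < \<eta>" "d \<le> \<alpha>/2"
      using \<open>\<eta> > 0\<close> \<open>\<alpha> > 0\<close> by (auto simp: d_def min_def)
    have "\<exists>w\<in>center_set Y G. dist v w \<le> \<epsilon>"
      if "G \<in> ?\<F>" and v: "v \<in> Y" "G \<subseteq> cball v (restricted_radius Y G + d)" for G v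
    proof -
      let ?R = "restricted_radius Y G"
      have G: "G \<noteq> {}" "bounded G" and "G \<in> CB" and R: "?R \<le> \<alpha>/2"
        using that by (auto simp: CB_def)
      obtain z where "z \<in> center_set Y G"
        using nonempty \<open>G \<in> CB\<close> R \<open>\<alpha> > 0\<close> by fastforce
      then have z: "z \<in> Y" "G \<subseteq> cball z ?R"
        unfolding center_set_eq[OF G] by auto
      show ?thesis
      proof (cases "v = z")
        case True
        then show ?thesis
          using \<open>z \<in> center_set Y G\<close> \<open>\<epsilon> > 0\<close> by (intro bexI[of _ z]) auto
      next
        case False
        then have "v - z \<noteq> 0"
          by simp
        note radius = dist_add_radius_le[OF this less_imp_le[OF \<open>0 < d\<close>]]
        \<comment> \<open>The reflection \<open>x \<mapsto> v + z - x\<close> swaps \<open>v\<close> and \<open>z\<close>. Fattening the reflected copy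
          makes \<open>v\<close> a center of \<open>G \<union> (v + z - G)\<close>, while fattening \<open>G\<close> itself keeps the
          centers inside those of \<open>G\<close>.\<close>
        have reflect: "dist u (v + z - g) = dist (v + z - u) g" for u g
        proof -
          have "u - (v + z - g) = - (v + z - u - g)"
            by (simp add: algebra_simps)
          then show ?thesis
            by (metis dist_norm norm_minus_cancel)
        qed
        define A where "A = G \<union> (\<Union>g\<in>G. cball (v + z - g) d)"
        define B where "B = (\<Union>g\<in>G. cball g d) \<union> (\<lambda>g. v + z - g) ` G"
        have fat: "cball p d \<subseteq> cball u (?R + d)" if "dist u p \<le> ?R" for u p :: 'a
        proof
          fix x assume "x \<in> cball p d"
          then show "x \<in> cball u (?R + d)"
            using that dist_triangle[of u x p] by simp
        qed
        have "cball (v + z - g) d \<subseteq> cball v (?R + d)" if "g \<in> G" for g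
          using z(2) that by (intro fat) (auto simp: reflect)
        then have Av: "A \<subseteq> cball v (?R + d)"
          using v(2) unfolding A_def by blast
        have "cball g d \<subseteq> cball z (?R + d)" if "g \<in> G" for g
          using z(2) that by (intro fat) auto
        moreover have "v + z - g \<in> cball z (?R + d)" if "g \<in> G" for g
          using v(2) that by (auto simp: reflect)
        ultimately have Bz: "B \<subseteq> cball z (?R + d)"
          unfolding B_def by blast
        have closure_iff: "closure S \<subseteq> cball u t \<longleftrightarrow> S \<subseteq> cball u t" for S :: "'a set" and u t
          using closure_minimal[OF _ closed_cball] closure_subset by blast
        have "A \<noteq> {}" "B \<noteq> {}"
          using G by (auto simp: A_def B_def)
        then have cl: "closure A \<noteq> {}" "bounded (closure A)" "closure B \<noteq> {}" "bounded (closure B)"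
          using bounded_closure[OF bounded_subset[OF bounded_cball Av]]
            bounded_closure[OF bounded_subset[OF bounded_cball Bz]] by simp_all
        then have CB: "closure A \<in> CB" "closure B \<in> CB"
          by (simp_all add: CB_def)
        \<comment> \<open>A ball of radius \<open>t\<close> around the fattened reflected copy
          leaves \<open>t - d\<close> for the copy itself; reflecting back gives a ball around
          \<open>G\<close> centered in \<open>Y\<close>.\<close>
        have "?R + d \<le> t" if u: "u \<in> Y" "closure A \<subseteq> cball u t" for u t
        proof -
          have "dist (v + z - u) g \<le> t - d" if "g \<in> G" for g
          proof -
            have "cball (v + z - g) d \<subseteq> cball u t"
              using u(2) that unfolding closure_iff A_def by blast
            from radius[OF this] show ?thesis
              by (simp add: reflect)
          qed
          then have "G \<subseteq> cball (v + z - u) (t - d)"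
            by auto
          moreover have "v + z - u \<in> Y"
            using u v z Y by (simp add: subspace_add subspace_diff)
          ultimately have "?R \<le> t - d"
            using restricted_radius_le[OF G] by blast
          then show ?thesis
            by simp
        qed
        then have "?R + d \<le> restricted_radius Y (closure A)"
          by (rule restricted_radius_ge[OF cl(1,2) Y_ne])
        moreover have "restricted_radius Y (closure A) \<le> ?R + d"
          using v Av by (intro restricted_radius_le[OF cl(1,2)]) (auto simp: closure_iff)
        ultimately have RA: "restricted_radius Y (closure A) = ?R + d"
          by simp
        have RB: "restricted_radius Y (closure B) \<le> ?R + d"
          using z Bz by (intro restricted_radius_le[OF cl(3,4)]) (auto simp: closure_iff)
        have small: "restricted_radius Y (closure A) \<le> \<alpha>" "restricted_radius Y (closure B) \<le> \<alpha>"
          using RA RB R d by simp_all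
        \<comment> \<open>Both sets contain \<open>G\<close> and its reflected copy and differ only
          in which of the two is fattened by \<open>d\<close>.\<close>
        have "Hausdorff_metric (closure A) (closure B) \<le> 2 * d"
        proof (rule Hausdorff_metric_closure_le[OF \<open>0 < d\<close>])
          show "\<exists>b\<in>B. dist a b \<le> d" if "a \<in> A" for a
            using that unfolding A_def
          proof
            assume "a \<in> G"
            moreover have "a \<in> cball a d"
              using \<open>0 < d\<close> by simp
            ultimately have "a \<in> B"
              unfolding B_def by blast
            then show ?thesis
              using \<open>0 < d\<close> by (intro bexI[of _ a]) auto
          next
            assume "a \<in> (\<Union>g\<in>G. cball (v + z - g) d)"
            then show ?thesis
              by (auto simp: B_def dist_commute)
          qed
          show "\<exists>a\<in>A. dist b a \<le> d" if "b \<in> B" for b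
            using that unfolding B_def
          proof
            assume "b \<in> (\<Union>g\<in>G. cball g d)"
            then show ?thesis
              by (auto simp: A_def dist_commute)
          next
            assume "b \<in> (\<lambda>g. v + z - g) ` G"
            moreover have "b \<in> cball b d"
              using \<open>0 < d\<close> by simp
            ultimately have "b \<in> A"
              unfolding A_def by blast
            then show ?thesis
              using \<open>0 < d\<close> by (intro bexI[of _ b]) auto
          qed
        qed
        also have "\<dots> < \<eta>"
          by (rule d)
        finally have "Hausdorff_metric (center_set Y (closure A)) (center_set Y (closure B)) < \<epsilon>"
          using \<eta> CB small by blast
        moreover have "center_set Y (closure A) \<in> CB" "center_set Y (closure B) \<in> CB"
          using cont CB small unfolding uniformly_Hausdorff_continuous_on_def by auto
        moreover have "v \<in> center_set Y (closure A)"
          using v(1) Av by (simp add: center_set_eq[OF cl(1,2)] RA closure_iff)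
        ultimately obtain w where "w \<in> center_set Y (closure B)" "dist v w \<le> \<epsilon>"
          using Hausdorff_metric_lessD(1) by blast
        then have "w \<in> Y" "B \<subseteq> cball w (restricted_radius Y (closure B))"
          by (auto simp: center_set_eq[OF cl(3,4)] closure_iff)
        \<comment> \<open>The ball about \<open>w\<close> contains all of \<open>cball g d\<close>
          and has radius at most \<open>?R + d\<close>; removing the fattening leaves
          \<open>?R\<close>.\<close>
        moreover have "dist w g \<le> ?R" if "g \<in> G" for g
        proof -
          have "cball g d \<subseteq> cball w (restricted_radius Y (closure B))"
            using calculation(2) that by (auto simp: B_def)
          from radius[OF this] RB show ?thesis
            by simp
        qed
        ultimately have "w \<in> center_set Y G"
          by (auto simp: center_set_eq[OF G])
        with \<open>dist v w \<le> \<epsilon>\<close> show ?thesis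
          by blast
      qed
    qed
    with d(1) show ?thesis
      by blast
  qed
  have "?\<F> \<subseteq> CB"
    by blast
  moreover have "center_set Y F \<noteq> {}" if "F \<in> ?\<F>" for F
    using nonempty[of F] that \<open>\<alpha> > 0\<close> by simp
  ultimately show ?thesis
    using near property_P2_iff by blast
qed

section \<open>The equivalences, with rotundity linking different levels\<close>

theorem theorem2p7:
  fixes Y :: "'a::banach set" and \<F> :: "'a set set" and \<alpha> :: real
  assumes "subspace Y" and "closed Y"
    and "\<alpha> > 0"
    and "\<F> = {F \<in> CB. restricted_radius Y F \<le> \<alpha>}"
  shows "(quasi_uniformly_rotund_wrt Y \<longleftrightarrow> property_P2 Y \<F>) \<and>
    (property_P2 Y \<F> \<longleftrightarrow>
       (\<forall>F\<in>\<F>. center_set Y F \<noteq> {}) \<and>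
       uniformly_Hausdorff_continuous_on \<F> Hausdorff_metric (center_set Y))"
proof -
  \<comment> \<open>Rotundity does not mention the level, so property (P2) transfers from
    \<open>\<alpha>/2\<close> back to \<open>\<alpha>\<close>.\<close>
  have rotund_iff: "quasi_uniformly_rotund_wrt Y \<longleftrightarrow>
      property_P2 Y {F \<in> CB. restricted_radius Y F \<le> \<beta>}" if "\<beta> > 0" for \<beta>
    using quasi_uniformly_rotund_imp_property_P2[OF assms(1,2) _ that]
      property_P2_imp_quasi_uniformly_rotund[OF assms(1) that] by blast
  have "Y \<noteq> {}" "\<F> \<subseteq> CB" "\<alpha>/2 > 0"
    using subspace_0[OF assms(1)] assms(3,4) by auto
  have "uniformly_Hausdorff_continuous_on \<F> Hausdorff_metric (center_set Y)"
    if "property_P2 Y \<F>"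
    using property_P2_imp_uniformly_Hausdorff_continuous_on[OF \<open>\<F> \<subseteq> CB\<close> assms(2) \<open>Y \<noteq> {}\<close> that] .
  moreover have "\<forall>F\<in>\<F>. center_set Y F \<noteq> {}" if "property_P2 Y \<F>"
    using that unfolding property_P2_def by blast
  moreover have "property_P2 Y \<F>"
    if "\<forall>F\<in>\<F>. center_set Y F \<noteq> {}"
      "uniformly_Hausdorff_continuous_on \<F> Hausdorff_metric (center_set Y)"
  proof -
    have "property_P2 Y {F \<in> CB. restricted_radius Y F \<le> \<alpha>/2}"
      using that assms(4)
      by (intro uniformly_Hausdorff_continuous_imp_property_P2[OF assms(1,3)]) auto
    then show ?thesis
      using rotund_iff assms(3,4) \<open>\<alpha>/2 > 0\<close> by blast
  qed
  moreover have "quasi_uniformly_rotund_wrt Y \<longleftrightarrow> property_P2 Y \<F>"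
    unfolding assms(4) by (rule rotund_iff[OF assms(3)])
  ultimately show ?thesis
    by blast
qed

end
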